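(* If $H$ is an expanded-clique graph, then $H$ is a line graph of a bipartite graph, i.e. there is a bipartite graph $B$ such that $H$ is isomorphic to the line graph $L(B)$.
   Context: All graphs are finite, simple and undirected. Let $G$ be a graph with vertex set $\{v_1,\dots,v_n\}$ and $f:V(G)\to\mathbb{N}$ a function with $f(v_i)\ge d_G(v_i)$ for every $i$. The expanded-clique graph $H$ of $(G,f)$ is the graph (unique up to isomorphism) defined as follows: $V(H)$ is the disjoint union of sets $V_1,\dots,V_n$, where $V_i$ has $f(v_i)$ vertices and forms a clique of $H$; for each edge $v_iv_j\in E(G)$ there are vertices $v_{i,j}\in V_i$ and $v_{j,i}\in V_j$ with $v_{i,j}v_{j,i}\in E(H)$, where the vertices $v_{i,j}$ (over all ordered pairs with $v_iv_j\in E(G)$) are pairwise distinct; and $H$ has no other edges. A graph is an expanded-clique graph if it is the expanded-clique graph of some pair $(G,f)$. The line graph $L(B)$ has vertex set $E(B)$, two distinct edges of $B$ being adjacent in $L(B)$ if and only if they share an endpoint. *)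

theory Defs
  imports Main "Graph_Theory.Graph_Theory"
begin

text \<open>
  A finite simple undirected graph is a \<^locale>\<open>pair_graph\<close>: a finite vertex set with a symmetric,
  irreflexive set of arcs, so that an edge between \<open>u\<close> and \<open>v\<close> is the pair of arcs \<open>(u, v)\<close>, \<open>(v, u)\<close>,
  and the degree of a vertex is its \<^const>\<open>out_degree\<close>. The null graph is allowed.
\<close>

text \<open>
  \<open>V u\<close> is the clique replacing the vertex \<open>u\<close> of \<open>G\<close>, and \<open>p u v\<close> is the vertex of \<open>V u\<close> incident
  with the edge of \<open>H\<close> that replaces the edge \<open>uv\<close> of \<open>G\<close>. Since every edge of \<open>G\<close> gives two arcs,
  injectivity of \<open>p\<close> on the arcs makes all the \<open>p u v\<close> and \<open>p v u\<close> pairwise distinct.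
  The predicate is closed under isomorphism of \<open>H\<close>.
\<close>

definition expanded_clique_graph_of ::
    "'a pair_pre_digraph \<Rightarrow> ('a \<Rightarrow> nat) \<Rightarrow> 'b pair_pre_digraph \<Rightarrow> bool" where
  "expanded_clique_graph_of G f H \<longleftrightarrow>
     pair_graph G \<and> pair_graph H \<and>
     (\<forall>u \<in> pverts G. out_degree (with_proj G) u \<le> f u) \<and>
     (\<exists>(V :: 'a \<Rightarrow> 'b set) (p :: 'a \<Rightarrow> 'a \<Rightarrow> 'b).
        pverts H = (\<Union>u \<in> pverts G. V u) \<and>
        (\<forall>u \<in> pverts G. \<forall>v \<in> pverts G. u \<noteq> v \<longrightarrow> V u \<inter> V v = {}) \<and>
        (\<forall>u \<in> pverts G. card (V u) = f u) \<and>
        (\<forall>(u, v) \<in> parcs G. p u v \<in> V u) \<and>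
        inj_on (\<lambda>(u, v). p u v) (parcs G) \<and>
        parcs H =
          {(x, y). x \<noteq> y \<and> (\<exists>u \<in> pverts G. x \<in> V u \<and> y \<in> V u)} \<union>
          {(p u v, p v u) | u v. (u, v) \<in> parcs G})"

definition bipartite :: "'a pair_pre_digraph \<Rightarrow> bool" where
  "bipartite B \<longleftrightarrow>
     (\<exists>X Y. pverts B = X \<union> Y \<and> X \<inter> Y = {} \<and> parcs B \<subseteq> X \<times> Y \<union> Y \<times> X)"

definition undirected_edges :: "'a pair_pre_digraph \<Rightarrow> 'a set set" where
  "undirected_edges B = {{u, v} | u v. (u, v) \<in> parcs B}"

definition line_graph :: "'a pair_pre_digraph \<Rightarrow> 'a set pair_pre_digraph" where
  "line_graph B =
     \<lparr> pverts = undirected_edges B,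
       parcs = {(e, e'). e \<in> undirected_edges B \<and> e' \<in> undirected_edges B \<and>
                         e \<noteq> e' \<and> e \<inter> e' \<noteq> {}} \<rparr>"

end

theory Submission
  imports Defs
begin

text \<open>
  In the bipartite graph, one side consists of the cliques \<open>V u\<close>, the other of the classes of the
  partition of \<open>V(H)\<close> into the pairs \<open>{p u v, p v u}\<close> and the remaining singletons. A vertex \<open>x\<close> of
  \<open>H\<close> becomes the edge joining its clique to its class. The two ends of a pair lie in different
  cliques, so distinct vertices become distinct edges, and two vertices are adjacent in \<open>H\<close> iff they
  share their clique or their class.
\<close>

text \<open>Arcs of a pair digraph are determined by their ends, so a vertex bijection
  \<open>h\<close> that carries arcs onto arcs already fixes the whole isomorphism.\<close>

lemma digraph_iso_with_projI:
  assumes "pair_wf_digraph H"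
    and inj: "inj_on h (pverts H)"
    and verts: "pverts K = h ` pverts H"
    and arcs: "parcs K = map_prod h h ` parcs H"
  shows "digraph_iso (with_proj H) (with_proj K)"
proof -
  interpret H: pair_wf_digraph H by fact
  define hom where
    "hom = \<lparr>iso_verts = h, iso_arcs = map_prod h h, iso_head = snd, iso_tail = fst\<rparr>"
  have "inj_on (map_prod h h) (pverts H \<times> pverts H)"
    using inj inj by (rule map_prod_inj_on)
  moreover have "parcs H \<subseteq> pverts H \<times> pverts H"
    using H.wellformed' by auto
  ultimately have "inj_on (map_prod h h) (parcs H)"
    by (rule inj_on_subset)
  then have "H.digraph_isomorphism hom"
    using inj by (auto simp: H.digraph_isomorphism_def hom_def intro: H.wf_digraph)
  moreover have "with_proj K = app_iso hom (with_proj H)"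
    by (simp add: with_proj_def app_iso_def hom_def verts arcs)
  ultimately show ?thesis
    unfolding digraph_iso_def by blast
qed

text \<open>The labels \<open>c x\<close> and \<open>q x\<close> serve as the two ends of an edge
  representing \<open>x\<close>. Injectivity of the pair of labels rules out parallel edges, so that
  \<open>B\<close> can be simple.\<close>

lemma line_graph_of_bipartiteI:
  fixes H :: "'b pair_pre_digraph" and c :: "'b \<Rightarrow> 'c" and q :: "'b \<Rightarrow> 'd"
  assumes H: "pair_graph H"
    and inj: "inj_on (\<lambda>x. (c x, q x)) (pverts H)"
    and arcs: "\<And>x y. x \<in> pverts H \<Longrightarrow> y \<in> pverts H \<Longrightarrow>
      (x, y) \<in> parcs H \<longleftrightarrow> x \<noteq> y \<and> (c x = c y \<or> q x = q y)"
  shows "\<exists>B :: nat pair_pre_digraph.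
           pair_graph B \<and> bipartite B \<and> digraph_iso (with_proj H) (with_proj (line_graph B))"
proof -
  interpret H: pair_graph H by fact
  obtain i :: "'c \<Rightarrow> nat" where i: "inj_on i (c ` pverts H)"
    using H.pair_finite_verts finite_imp_inj_to_nat_seg by (metis finite_imageI)
  obtain j :: "'d \<Rightarrow> nat" where j: "inj_on j (q ` pverts H)"
    using H.pair_finite_verts finite_imp_inj_to_nat_seg by (metis finite_imageI)
  \<comment> \<open>Even and odd numbers keep the two sides of \<open>B\<close> disjoint, even where
    the values of \<open>i\<close> and \<open>j\<close> overlap.\<close>
  define l where "l x = 2 * i (c x)" for x
  define r where "r x = 2 * j (q x) + 1" for x
  have l_eq: "l x = l y \<longleftrightarrow> c x = c y" if "x \<in> pverts H" "y \<in> pverts H" for x y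
    using that inj_on_eq_iff[OF i] by (simp add: l_def)
  have r_eq: "r x = r y \<longleftrightarrow> q x = q y" if "x \<in> pverts H" "y \<in> pverts H" for x y
    using that inj_on_eq_iff[OF j] by (simp add: r_def)
  have l_neq_r: "l x \<noteq> r y" "r y \<noteq> l x" for x y
    unfolding l_def r_def by presburger+
  define B where "B = \<lparr>pverts = l ` pverts H \<union> r ` pverts H,
    parcs = (\<lambda>x. (l x, r x)) ` pverts H \<union> (\<lambda>x. (r x, l x)) ` pverts H\<rparr>"
  define h where "h x = {l x, r x}" for x
  have "pair_graph B"
  proof
    show "symmetric (with_proj B)"
      unfolding symmetric_def by (auto simp: B_def intro: symI)
  qed (auto simp: B_def H.pair_finite_verts l_neq_r)
  moreover have "bipartite B"
    unfolding bipartite_def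
    by (rule exI[of _ "l ` pverts H"], rule exI[of _ "r ` pverts H"]) (auto simp: B_def l_neq_r)
  moreover have "digraph_iso (with_proj H) (with_proj (line_graph B))"
  proof (rule digraph_iso_with_projI)
    show "pair_wf_digraph H" ..
    show inj_h: "inj_on h (pverts H)"
    proof (rule inj_onI)
      fix x y assume xy: "x \<in> pverts H" "y \<in> pverts H" and "h x = h y"
      then have "l x = l y" "r x = r y"
        by (auto simp: h_def doubleton_eq_iff l_neq_r)
      with xy show "x = y"
        using inj by (auto simp: l_eq r_eq dest: inj_onD)
    qed
    have edges: "undirected_edges B = h ` pverts H"
      by (auto simp: undirected_edges_def B_def h_def insert_commute)
    then show "pverts (line_graph B) = h ` pverts H"
      by (simp add: line_graph_def)
    have adj: "(x, y) \<in> parcs H \<longleftrightarrow> h x \<noteq> h y \<and> h x \<inter> h y \<noteq> {}"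
      if "x \<in> pverts H" "y \<in> pverts H" for x y
    proof -
      \<comment> \<open>Ends on opposite sides never coincide, so a common endpoint is a common
        \<open>l\<close> or a common \<open>r\<close>.\<close>
      have "h x \<inter> h y \<noteq> {} \<longleftrightarrow> c x = c y \<or> q x = q y"
        using that by (auto simp: h_def l_neq_r l_eq r_eq)
      then show ?thesis
        using that inj_on_eq_iff[OF inj_h] by (simp add: arcs)
    qed
    show "parcs (line_graph B) = map_prod h h ` parcs H"
    proof (intro subset_antisym subrelI)
      fix e e' assume "(e, e') \<in> parcs (line_graph B)"
      then obtain x y where "x \<in> pverts H" "y \<in> pverts H" "e = h x" "e' = h y"
          "h x \<noteq> h y" "h x \<inter> h y \<noteq> {}"
        by (auto simp: line_graph_def edges)
      then show "(e, e') \<in> map_prod h h ` parcs H"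
        using adj by force
    next
      fix e e' assume "(e, e') \<in> map_prod h h ` parcs H"
      then obtain x y where "(x, y) \<in> parcs H" "e = h x" "e' = h y"
        by auto
      then show "(e, e') \<in> parcs (line_graph B)"
        using adj[of x y] H.wellformed'[of x y] by (simp add: line_graph_def edges)
    qed
  qed
  ultimately show ?thesis
    by blast
qed

theorem theorem2p3:
  fixes G :: "'a pair_pre_digraph" and f :: "'a \<Rightarrow> nat" and H :: "'b pair_pre_digraph"
  assumes "expanded_clique_graph_of G f H"
  shows "\<exists>B :: nat pair_pre_digraph.
           pair_graph B \<and> bipartite B \<and> digraph_iso (with_proj H) (with_proj (line_graph B))"
proof -
  obtain V :: "'a \<Rightarrow> 'b set" and p :: "'a \<Rightarrow> 'a \<Rightarrow> 'b" where
    G: "pair_graph G" and H: "pair_graph H"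
    and verts: "pverts H = (\<Union>u \<in> pverts G. V u)"
    and disj: "\<forall>u \<in> pverts G. \<forall>v \<in> pverts G. u \<noteq> v \<longrightarrow> V u \<inter> V v = {}"
    and p: "\<forall>(u, v) \<in> parcs G. p u v \<in> V u"
    and inj: "inj_on (\<lambda>(u, v). p u v) (parcs G)"
    and arcs: "parcs H =
          {(x, y). x \<noteq> y \<and> (\<exists>u \<in> pverts G. x \<in> V u \<and> y \<in> V u)} \<union>
          {(p u v, p v u) | u v. (u, v) \<in> parcs G}"
    using assms unfolding expanded_clique_graph_of_def by (elim conjE exE) (rule that)
  interpret G: pair_graph G by fact
  \<comment> \<open>\<open>M\<close> is the set of arcs of \<open>H\<close> that come from edges of
    \<open>G\<close>. It is a matching: symmetric because \<open>G\<close> is, and single-valued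
    because \<open>p\<close> is injective on arcs.\<close>
  define M where "M = {(p u v, p v u) | u v. (u, v) \<in> parcs G}"
  have sym_G: "(v, u) \<in> parcs G" if "(u, v) \<in> parcs G" for u v
    using G.pair_sym_arcs that by (auto simp: symmetric_def dest: symD)
  have p_inj: "u = u' \<and> v = v'"
    if "(u, v) \<in> parcs G" "(u', v') \<in> parcs G" "p u v = p u' v'" for u v u' v'
    using inj_onD[OF inj, of "(u, v)" "(u', v')"] that by simp
  have M_sym: "(y, x) \<in> M" if "(x, y) \<in> M" for x y
    using that sym_G by (auto simp: M_def)
  have M_fun: "y = z" if "(x, y) \<in> M" "(x, z) \<in> M" for x y z
    using that by (auto simp: M_def dest: p_inj)
  obtain c where c: "\<And>x. x \<in> pverts H \<Longrightarrow> c x \<in> pverts G \<and> x \<in> V (c x)"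
    using verts by (metis UN_E)
  have c_eq: "c x = u" if "u \<in> pverts G" "x \<in> V u" for u x
    using that c[of x] disj verts by blast
  \<comment> \<open>The class of \<open>x\<close>: the pair of \<open>x\<close> and its partner if
    \<open>x\<close> is matched by \<open>M\<close>, and the singleton otherwise.\<close>
  define q where "q x = insert x (M `` {x})" for x
  have q_eq: "q x = q y \<longleftrightarrow> x = y \<or> (x, y) \<in> M" for x y
    using M_sym M_fun by (fastforce simp: q_def)
  \<comment> \<open>Since \<open>G\<close> has no loops, matched vertices lie in the cliques of two
    different vertices of \<open>G\<close>.\<close>
  have M_c: "c x \<noteq> c y" if "(x, y) \<in> M" for x y
  proof -
    from that obtain u v where uv: "(u, v) \<in> parcs G" and "x = p u v" "y = p v u"
      by (auto simp: M_def)
    moreover have "p u v \<in> V u" "p v u \<in> V v"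
      using p uv sym_G[OF uv] by auto
    moreover have "u \<noteq> v"
      using G.pair_no_loops[OF uv] by simp
    ultimately show ?thesis
      using G.wellformed'[OF uv] c_eq by metis
  qed
  show ?thesis
  proof (rule line_graph_of_bipartiteI[OF H, of c q])
    \<comment> \<open>Distinct vertices with the same class are matched, hence differ in
      \<open>c\<close>.\<close>
    show "inj_on (\<lambda>x. (c x, q x)) (pverts H)"
      using M_c by (auto simp: inj_on_def q_eq)
  next
    fix x y assume xy: "x \<in> pverts H" "y \<in> pverts H"
    have "(\<exists>u \<in> pverts G. x \<in> V u \<and> y \<in> V u) \<longleftrightarrow> c x = c y"
      using c[OF xy(1)] c[OF xy(2)] c_eq by metis
    \<comment> \<open>In \<open>arcs\<close> only the clique part demands
      \<open>x \<noteq> y\<close>; this supplies it for the matching part.\<close>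
    moreover have "(x, y) \<in> M \<Longrightarrow> x \<noteq> y"
      using M_c by blast
    ultimately show "(x, y) \<in> parcs H \<longleftrightarrow> x \<noteq> y \<and> (c x = c y \<or> q x = q y)"
      unfolding arcs M_def[symmetric] q_eq by auto
  qed
qed

end
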